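(* Let $\lambda_1,\dots,\lambda_n\in\mathbb R$ and let $A$ be a unital complex $C^*$-algebra. Suppose $a_0,a_1\in S_p(A)$, where $a_0$ is fixed and $\|a_1-a_0\|$ is sufficiently small. Then $a_0$ and $a_1$ are similar via a unitary, $$a_1=e^{-ic}a_0e^{ic},\qquad\text{where } c=c^*\in A \text{ and } \|c\| \text{ is small}$$ (that is, for every $\varepsilon>0$ there is $\delta>0$ such that for every $a_1\in S_p(A)$ with $\|a_1-a_0\|<\delta$ such a $c$ exists with $\|c\|<\varepsilon$). This gives a self-adjoint analytic path $a(t)\in S_p(A)$, $t\in[0,1]$, from $a_0$ to $a_1$, namely $$a(t)=a(t)^*=e^{-ict}a_0e^{ict},$$ and the distance of this path from $a_0$ tends to $0$ as $\|a_1-a_0\|\to0$, i.e. $\sup_{t\in[0,1]}\|a(t)-a_0\|\to0$. Hence the connected component of $a_0$ in $S_p(A)$ is locally pathwise connected via similarity with a unitary-valued exponential function (paths of the form $t\mapsto e^{-ict}a_0e^{ict}$, $c=c^*$).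
   Context: Fix an integer $n\ge2$ and distinct $\lambda_1,\dots,\lambda_n$, and let $p(\lambda)=\prod_{i=1}^n(\lambda-\lambda_i)$. For a unital complex $C^*$-algebra $A$, $S_p(A)=\{a\in A\mid a=a^*,\ p(a)=0\}$, with the norm topology of $A$. *)

theory Defs
  imports "HOL-Analysis.Analysis" "HOL-Computational_Algebra.Polynomial"
begin

text \<open>
  Unital complex C*-algebras as a type class. Completeness, submultiplicativity of the norm,
  \<open>1 \<noteq> 0\<close> and \<open>norm 1 = 1\<close> are inherited; complex scalar multiplication extends the inherited
  real one.
\<close>

class unital_cstar_algebra = real_normed_algebra_1 + banach +
  fixes scaleC :: "complex \<Rightarrow> 'a \<Rightarrow> 'a"  (infixr \<open>*\<^sub>C\<close> 75)
    and star :: "'a \<Rightarrow> 'a"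
  assumes scaleC_add_right: "z *\<^sub>C (x + y) = z *\<^sub>C x + z *\<^sub>C y"
    and scaleC_add_left: "(z + w) *\<^sub>C x = z *\<^sub>C x + w *\<^sub>C x"
    and scaleC_scaleC: "z *\<^sub>C w *\<^sub>C x = (z * w) *\<^sub>C x"
    and scaleC_of_real: "complex_of_real r *\<^sub>C x = r *\<^sub>R x"
    and mult_scaleC_left: "(z *\<^sub>C x) * y = z *\<^sub>C (x * y)"
    and mult_scaleC_right: "x * (z *\<^sub>C y) = z *\<^sub>C (x * y)"
    and norm_scaleC: "norm (z *\<^sub>C x) = cmod z * norm x"
    and star_star: "star (star x) = x"
    and star_add: "star (x + y) = star x + star y"
    and star_scaleC: "star (z *\<^sub>C x) = cnj z *\<^sub>C star x"
    and star_mult: "star (x * y) = star y * star x"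
    and cstar_identity: "norm (star x * x) = (norm x)\<^sup>2"

definition self_adjoint :: "'a::unital_cstar_algebra \<Rightarrow> bool" where
  "self_adjoint a \<longleftrightarrow> star a = a"

definition unitary :: "'a::unital_cstar_algebra \<Rightarrow> bool" where
  "unitary u \<longleftrightarrow> star u * u = 1 \<and> u * star u = 1"

definition poly_eval :: "complex poly \<Rightarrow> 'a::unital_cstar_algebra \<Rightarrow> 'a" where
  "poly_eval p a = (\<Sum>k\<le>degree p. coeff p k *\<^sub>C a ^ k)"

definition sa_roots :: "complex poly \<Rightarrow> 'a::unital_cstar_algebra set" where
  "sa_roots p = {a. self_adjoint a \<and> poly_eval p a = 0}"

text \<open>The path \<open>t \<mapsto> e\<^sup>-\<^sup>i\<^sup>c\<^sup>t a e\<^sup>i\<^sup>c\<^sup>t\<close>.\<close>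

definition exp_path :: "'a::unital_cstar_algebra \<Rightarrow> 'a \<Rightarrow> real \<Rightarrow> 'a" where
  "exp_path a c t =
     exp (- (\<i> * complex_of_real t) *\<^sub>C c) * a * exp ((\<i> * complex_of_real t) *\<^sub>C c)"

text \<open>Real analyticity relative to \<open>T\<close>: at an endpoint of an interval the expansion is one-sided.\<close>

definition real_analytic_on :: "(real \<Rightarrow> 'a::real_normed_vector) \<Rightarrow> real set \<Rightarrow> bool" where
  "real_analytic_on f T \<longleftrightarrow>
     (\<forall>s\<in>T. \<exists>r>0. \<exists>b. \<forall>t\<in>T. \<bar>t - s\<bar> < r \<longrightarrow> (\<lambda>k. (t - s) ^ k *\<^sub>R b k) sums f t)"

definition exp_joined :: "'a::unital_cstar_algebra set \<Rightarrow> 'a \<Rightarrow> 'a \<Rightarrow> bool" where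
  "exp_joined V x y \<longleftrightarrow>
     (\<exists>c. self_adjoint c \<and> exp_path x c 1 = y \<and> (\<forall>t\<in>{0..1}. exp_path x c t \<in> V))"

text \<open>
  Local path connectedness with all paths of the form \<^const>\<open>exp_path\<close>. The shape is that of
  \<^const>\<open>locally\<close>: each point \<open>b\<close> has arbitrarily small (not necessarily open) neighbourhoods \<open>V\<close>
  all of whose points are joined to \<open>b\<close> inside \<open>V\<close>; moreover any two points close enough to \<open>b\<close>
  are joined inside \<open>V\<close> by a single such path.
\<close>

definition locally_exp_path_connected :: "'a::unital_cstar_algebra set \<Rightarrow> bool" where
  "locally_exp_path_connected K \<longleftrightarrow>
     (\<forall>W b. openin (top_of_set K) W \<and> b \<in> W \<longrightarrow>
        (\<exists>U V. openin (top_of_set K) U \<and> b \<in> U \<and> U \<subseteq> V \<and> V \<subseteq> W \<and>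
           (\<forall>x\<in>V. exp_joined V b x) \<and>
           (\<forall>x\<in>U. \<forall>y\<in>U. exp_joined V x y)))"

end

theory Submission
  imports Defs
begin

text \<open>
  Let \<open>x\<close> and \<open>y\<close> be self-adjoint roots of \<open>p\<close> close to each other, and let \<open>L\<^sub>i\<close> be the Lagrange
  polynomials of the nodes \<open>\<lambda>\<^sub>i\<close>. Since \<open>(\<lambda> - \<lambda>\<^sub>i) L\<^sub>i\<close> is a multiple of \<open>p\<close>, the element \<open>L\<^sub>i(x)\<close> is the
  spectral idempotent of \<open>x\<close> for \<open>\<lambda>\<^sub>i\<close>. Hence \<open>v = \<Sum>\<^sub>i L\<^sub>i(y) L\<^sub>i(x)\<close> satisfies \<open>y v = v x\<close>, it is
  continuous in \<open>(x, y)\<close>, and it equals \<open>1\<close> for \<open>x = y\<close>. So nearby roots are similar through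
  an element near \<open>1\<close> (\<open>intertwiner_near_one\<close>).

  It remains to replace \<open>v\<close> by a unitary exponential. Instead of functional calculus only the
  behaviour of \<open>exp\<close> near \<open>0\<close> is used. There \<open>exp - id\<close> is a contraction, so \<open>exp\<close> is injective
  on a small ball, and every \<open>g\<close> near \<open>1\<close> has a small logarithm commuting with everything that
  commutes with \<open>g\<close> (\<open>exp_inj_small\<close>, \<open>small_log_exists\<close>). Injectivity transports symmetry from
  an element to its small logarithm: the logarithm of a self-adjoint element is self-adjoint, and that of
  a unitary is skew-adjoint. Let \<open>h\<close> be the small logarithm of \<open>v\<^sup>* v\<close>. As \<open>v\<^sup>* v\<close> commutes with \<open>x\<close>,
  so does \<open>h\<close>, and \<open>u = v exp (- h / 2)\<close> is a unitary near \<open>1\<close> with \<open>y u = u x\<close>. Its small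
  logarithm \<open>z\<close> is skew-adjoint, and \<open>c = \<i> z\<close> is the required self-adjoint element
  (\<open>similar_imp_exp_path\<close>).

  All this is uniform for \<open>x\<close> and \<open>y\<close> near a given root \<open>b\<close>
  (\<open>nearby_joined_by_small_exp_path\<close>), which yields the local connectedness of the components.
  The neighbourhood used there is \<open>V = {e\<^sup>-\<^sup>i\<^sup>c b e\<^sup>i\<^sup>c | \<parallel>c\<parallel> < \<eta>}\<close>: it is star-shaped about \<open>b\<close> with
  respect to exponential paths, because \<open>c\<close> may be replaced by \<open>t c\<close>, and it contains all roots
  sufficiently near \<open>b\<close>.
\<close>

section \<open>Elementary facts about the algebra operations\<close>

lemma bounded_linear_scaleC: "bounded_linear (\<lambda>x::'a::unital_cstar_algebra. z *\<^sub>C x)"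
proof (rule bounded_linear_intro)
  fix r and x :: 'a
  show "z *\<^sub>C (r *\<^sub>R x) = r *\<^sub>R (z *\<^sub>C x)"
    by (simp add: scaleC_of_real[symmetric] scaleC_scaleC mult.commute)
  show "norm (z *\<^sub>C x) \<le> norm x * cmod z"
    by (simp add: norm_scaleC)
qed (rule scaleC_add_right)

lemma scaleC_zero_right [simp]: "z *\<^sub>C (0::'a::unital_cstar_algebra) = 0"
  by (rule linear_0[OF bounded_linear.linear[OF bounded_linear_scaleC]])

lemma scaleC_zero_left [simp]: "0 *\<^sub>C (x::'a::unital_cstar_algebra) = 0"
  using scaleC_of_real[of 0 x] by simp

lemma scaleC_one [simp]: "1 *\<^sub>C (x::'a::unital_cstar_algebra) = x"
  using scaleC_of_real[of 1 x] by simp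

lemma scaleC_minus_left: "(- z) *\<^sub>C (x::'a::unital_cstar_algebra) = - (z *\<^sub>C x)"
  using scaleC_add_left[of "- z" z x] by (simp add: eq_neg_iff_add_eq_0)

text \<open>
  The C*-identity gives \<open>\<parallel>x\<parallel>\<^sup>2 = \<parallel>x\<^sup>* x\<parallel> \<le> \<parallel>x\<^sup>*\<parallel> \<parallel>x\<parallel>\<close>; applying this also to \<open>x\<^sup>*\<close> gives equality.
\<close>

lemma norm_star: "norm (star x) = norm (x::'a::unital_cstar_algebra)"
proof -
  have le: "norm y \<le> norm (star y)" for y :: 'a
  proof (cases "norm y = 0")
    case False
    have "(norm y)\<^sup>2 \<le> norm (star y) * norm y"
      using norm_mult_ineq[of "star y" y] by (simp add: cstar_identity)
    then show ?thesis using False by (simp add: power2_eq_square)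
  qed simp
  show ?thesis using le[of x] le[of "star x"] by (simp add: star_star)
qed

lemma bounded_linear_star: "bounded_linear (star :: 'a::unital_cstar_algebra \<Rightarrow> 'a)"
proof (rule bounded_linear_intro)
  fix r and x :: 'a
  show "star (r *\<^sub>R x) = r *\<^sub>R star x"
    by (simp add: scaleC_of_real[symmetric] star_scaleC)
  show "norm (star x) \<le> norm x * 1"
    by (simp add: norm_star)
qed (rule star_add)

lemmas star_minus = linear_neg[OF bounded_linear.linear[OF bounded_linear_star]]
  and star_diff = linear_diff[OF bounded_linear.linear[OF bounded_linear_star]]
  and star_scaleR = linear_scale[OF bounded_linear.linear[OF bounded_linear_star]]

lemma star_one [simp]: "star (1::'a::unital_cstar_algebra) = 1"
  by (metis mult_1_left mult_1_right star_mult star_star)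

lemma star_power: "star (x ^ n) = star (x::'a::unital_cstar_algebra) ^ n"
  by (induction n) (simp_all add: star_mult power_commutes)

lemma star_exp: "star (exp x) = exp (star (x::'a::unital_cstar_algebra))"
proof -
  have "(\<lambda>n. star (x ^ n /\<^sub>R fact n)) sums star (exp x)"
    by (rule bounded_linear.sums[OF bounded_linear_star exp_converges])
  then have "(\<lambda>n. star x ^ n /\<^sub>R fact n) sums star (exp x)"
    by (simp add: star_scaleR star_power)
  then show ?thesis using exp_converges sums_unique2 by blast
qed

lemma exp_commute:
  fixes x y :: "'a::{real_normed_algebra_1,banach}"
  assumes "x * y = y * x"
  shows "exp x * y = y * exp x"
proof -
  have "x ^ n * y = y * x ^ n" for n
    by (rule power_commuting_commutes[OF assms])
  then have "(\<lambda>n. x ^ n /\<^sub>R fact n * y) = (\<lambda>n. y * (x ^ n /\<^sub>R fact n))"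
    by simp
  then show ?thesis
    using sums_mult2[OF exp_converges, of x y] sums_mult[OF exp_converges, of y x]
      sums_unique2 by metis
qed

lemma norm_unitary:
  fixes u :: "'a::unital_cstar_algebra"
  assumes "unitary u"
  shows "norm u = 1"
  using assms cstar_identity[of u] by (simp add: unitary_def power2_eq_1_iff) (smt (verit) norm_ge_zero)

section \<open>The exponential near zero\<close>

lemma norm_power_Suc_diff_le:
  fixes x y :: "'a::real_normed_algebra_1"
  assumes "norm x \<le> r" "norm y \<le> r"
  shows "norm (x ^ Suc n - y ^ Suc n) \<le> real (Suc n) * r ^ n * norm (x - y)"
proof (induction n)
  case (Suc n)
  have r: "r \<ge> 0" using assms norm_ge_zero order_trans by blast
  have "x ^ Suc (Suc n) - y ^ Suc (Suc n) = x * (x ^ Suc n - y ^ Suc n) + (x - y) * y ^ Suc n"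
    by (simp add: algebra_simps)
  also have "norm \<dots> \<le> norm x * norm (x ^ Suc n - y ^ Suc n) + norm (x - y) * norm (y ^ Suc n)"
    by (intro norm_triangle_le add_mono norm_mult_ineq)
  also have "\<dots> \<le> r * (real (Suc n) * r ^ n * norm (x - y)) + norm (x - y) * r ^ Suc n"
    using Suc assms r norm_power_ineq[of y "Suc n"] power_mono[OF assms(2), of "Suc n"]
    by (intro add_mono mult_mono mult_left_mono) auto
  finally show ?case by (simp add: algebra_simps)
qed simp

text \<open>
  In the power series of \<open>(exp x - x) - (exp y - y)\<close> the terms of degree \<open>0\<close> and \<open>1\<close> cancel. The
  term of degree \<open>n + 2\<close> is at most \<open>r\<^bsup>n+1\<^esup> / (n + 1)! \<parallel>x - y\<parallel>\<close>, and these bounds add up to the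
  exponential series at \<open>r\<close> without its first term.
\<close>

lemma exp_remainder_Lipschitz:
  fixes x y :: "'a::{real_normed_algebra_1,banach}"
  assumes "norm x \<le> r" "norm y \<le> r"
  shows "norm ((exp x - x) - (exp y - y)) \<le> (exp r - 1) * norm (x - y)"
proof (rule norm_sums_le)
  let ?f = "\<lambda>n. x ^ n /\<^sub>R fact n - y ^ n /\<^sub>R fact n"
  have "?f sums (exp x - exp y)"
    by (intro sums_diff exp_converges)
  from sums_split_initial_segment[OF this, of 2]
  show "(\<lambda>n. ?f (n + 2)) sums ((exp x - x) - (exp y - y))"
    by (simp add: numeral_2_eq_2 algebra_simps)
  have "(\<lambda>n. r ^ n /\<^sub>R fact n) sums exp r"
    by (rule exp_converges)
  from sums_mult2[OF sums_split_initial_segment[OF this, of 1], of "norm (x - y)"]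
  show "(\<lambda>n. r ^ (n + 1) /\<^sub>R fact (n + 1) * norm (x - y)) sums ((exp r - 1) * norm (x - y))"
    by simp
  show "norm (?f (n + 2)) \<le> r ^ (n + 1) /\<^sub>R fact (n + 1) * norm (x - y)" for n
  proof -
    have "norm (?f (n + 2)) = norm (x ^ Suc (Suc n) - y ^ Suc (Suc n)) / fact (n + 2)"
      by (simp add: scaleR_diff_right[symmetric] divide_inverse mult.commute)
    also have "\<dots> \<le> real (Suc (Suc n)) * r ^ Suc n * norm (x - y) / fact (n + 2)"
      by (intro divide_right_mono norm_power_Suc_diff_le assms) simp
    also have "\<dots> = r ^ (n + 1) /\<^sub>R fact (n + 1) * norm (x - y)"
    proof -
      have "(fact (n + 2) :: real) = real (Suc (Suc n)) * fact (n + 1)" by simp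
      then show ?thesis by (simp only:) (simp add: divide_simps del: fact_Suc)
    qed
    finally show ?thesis .
  qed
qed

lemma norm_exp_minus_one_le:
  fixes x :: "'a::{real_normed_algebra_1,banach}"
  shows "norm (exp x - 1) \<le> exp (norm x) * norm x"
proof -
  have "norm ((exp x - x) - (exp 0 - 0)) \<le> (exp (norm x) - 1) * norm (x - 0)"
    by (rule exp_remainder_Lipschitz) auto
  then show ?thesis
    using norm_triangle_sub[of "exp x - 1" x] by (simp add: algebra_simps)
qed

lemma exp_quarter_le: "exp (1/4::real) \<le> 3/2"
  using exp_bound[of "1/4"] by (simp add: power2_eq_square)

text \<open>
  The radius \<open>1/4\<close> is chosen so that \<open>exp r - 1 \<le> 1/2\<close>.
\<close>

lemma exp_half_Lipschitz:
  fixes x y :: "'a::{real_normed_algebra_1,banach}"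
  assumes "norm x \<le> 1/4" "norm y \<le> 1/4"
  shows "norm ((exp x - x) - (exp y - y)) \<le> 1/2 * norm (x - y)"
  using exp_remainder_Lipschitz[OF assms] exp_quarter_le
    mult_right_mono[of "exp (1/4) - 1" "1/2" "norm (x - y)"] by simp

lemma exp_inj_small:
  fixes x y :: "'a::{real_normed_algebra_1,banach}"
  assumes "norm x \<le> 1/4" "norm y \<le> 1/4" "exp x = exp y"
  shows "x = y"
  using exp_half_Lipschitz[OF assms(1,2)] assms(3) by (simp add: norm_minus_commute)

text \<open>
  A solution of \<open>exp x = g\<close> is a fixed point of \<open>x \<mapsto> x - exp x + g\<close>, a contraction of the
  ball of radius \<open>2 \<parallel>g - 1\<parallel>\<close>. It maps the closed subalgebra of elements commuting with the
  commutant of \<open>g\<close> into itself, so the fixed point is found there. That is how \<open>x\<close> inherits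
  the commutation relations of \<open>g\<close>.
\<close>

lemma small_log_exists:
  fixes g :: "'a::{real_normed_algebra_1,banach}"
  assumes "norm (g - 1) \<le> 1/8"
  obtains x where "exp x = g" "norm x \<le> 2 * norm (g - 1)" "\<And>y. g * y = y * g \<Longrightarrow> x * y = y * x"
proof -
  define r where "r = 2 * norm (g - 1)"
  define S where "S = cball 0 r \<inter> (\<Inter>y\<in>{y. g * y = y * g}. {x. x * y = y * x})"
  define T where "T = (\<lambda>x. x - exp x + g)"
  have r: "0 \<le> r" "r \<le> 1/4" using assms by (auto simp: r_def)
  have "closed {x. x * y = y * x}" for y :: 'a
    by (intro closed_Collect_eq continuous_intros)
  then have "complete S"
    unfolding S_def complete_eq_closed by (intro closed_Int closed_cball closed_INT) auto
  moreover have "S \<noteq> {}"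
  proof -
    have "0 \<in> S" using r by (simp add: S_def)
    then show ?thesis by blast
  qed
  moreover have "T ` S \<subseteq> S"
  proof safe
    fix x assume x: "x \<in> S"
    then have nx: "norm x \<le> r" by (simp add: S_def)
    have "norm ((exp x - x) - (exp 0 - 0)) \<le> 1/2 * norm (x - 0)"
      using nx r by (intro exp_half_Lipschitz) auto
    moreover have "T x = (g - 1) - ((exp x - x) - (exp 0 - 0))"
      by (simp add: T_def)
    ultimately have "norm (T x) \<le> norm (g - 1) + 1/2 * norm x"
      by (metis diff_zero norm_triangle_le_diff add_left_mono)
    then have "norm (T x) \<le> r" using nx by (simp add: r_def)
    moreover have "T x * y = y * T x" if "g * y = y * g" for y
    proof -
      have "x * y = y * x" using x that by (auto simp: S_def)
      then show ?thesis using exp_commute[of x y] that by (simp add: T_def algebra_simps)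
    qed
    ultimately show "T x \<in> S" by (simp add: S_def)
  qed
  moreover have "dist (T x) (T y) \<le> 1/2 * dist x y" if "x \<in> S" "y \<in> S" for x y
  proof -
    have "norm ((exp x - x) - (exp y - y)) \<le> 1/2 * norm (x - y)"
      using that r by (intro exp_half_Lipschitz) (auto simp: S_def)
    moreover have "T x - T y = - ((exp x - x) - (exp y - y))" by (simp add: T_def)
    ultimately show ?thesis by (metis dist_norm norm_minus_cancel)
  qed
  ultimately obtain x where "x \<in> S" "T x = x"
    using Banach_fix[of S "1/2" T] by auto
  then show ?thesis by (intro that[of x]) (auto simp: S_def T_def r_def)
qed


section \<open>Evaluating polynomials at algebra elements\<close>

lemma poly_eval_eq_sum:
  assumes "degree p \<le> N"
  shows "poly_eval p (a::'a::unital_cstar_algebra) = (\<Sum>k\<le>N. coeff p k *\<^sub>C a ^ k)"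
  unfolding poly_eval_def
  by (rule sum.mono_neutral_left) (use assms in \<open>auto simp: coeff_eq_0\<close>)

lemma poly_eval_add:
  "poly_eval (p + q) (a::'a::unital_cstar_algebra) = poly_eval p a + poly_eval q a"
proof -
  define N where "N = max (degree p) (degree q)"
  show ?thesis
    by (subst (1 2 3) poly_eval_eq_sum[where N = N])
       (auto simp: N_def degree_add_le scaleC_add_left sum.distrib)
qed

lemma poly_eval_0 [simp]: "poly_eval 0 (a::'a::unital_cstar_algebra) = 0"
  by (simp add: poly_eval_def)

text \<open>
  The Horner step. It reduces the multiplicativity of evaluation and its compatibility with
  conjugation to inductions over polynomials.
\<close>

lemma poly_eval_pCons:
  "poly_eval (pCons z p) (a::'a::unital_cstar_algebra) = z *\<^sub>C 1 + a * poly_eval p a"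
proof -
  have "poly_eval (pCons z p) a = (\<Sum>k\<le>Suc (degree p). coeff (pCons z p) k *\<^sub>C a ^ k)"
    by (rule poly_eval_eq_sum) (simp add: degree_pCons_le)
  also have "\<dots> = z *\<^sub>C 1 + (\<Sum>k\<le>degree p. coeff p k *\<^sub>C (a * a ^ k))"
    by (simp add: sum.atMost_Suc_shift del: sum.atMost_Suc)
  finally show ?thesis
    by (simp add: poly_eval_def sum_distrib_left mult_scaleC_right)
qed

lemma poly_eval_smult:
  "poly_eval (smult z p) (a::'a::unital_cstar_algebra) = z *\<^sub>C poly_eval p a"
  by (induction p) (simp_all add: poly_eval_pCons scaleC_add_right scaleC_scaleC mult_scaleC_right)

lemma poly_eval_mult:
  "poly_eval (p * q) (a::'a::unital_cstar_algebra) = poly_eval p a * poly_eval q a"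
  by (induction p) (simp_all add: poly_eval_pCons poly_eval_add poly_eval_smult
      mult_scaleC_left algebra_simps)

lemma poly_eval_1 [simp]: "poly_eval 1 (a::'a::unital_cstar_algebra) = 1"
  by (simp add: one_pCons poly_eval_pCons)

lemma poly_eval_sum:
  "poly_eval (\<Sum>i\<in>I. f i) (a::'a::unital_cstar_algebra) = (\<Sum>i\<in>I. poly_eval (f i) a)"
  by (induction I rule: infinite_finite_induct) (simp_all add: poly_eval_add)

lemma continuous_poly_eval:
  "continuous_on UNIV (poly_eval p :: 'a::unital_cstar_algebra \<Rightarrow> 'a)"
  unfolding poly_eval_def
  by (intro continuous_on_sum bounded_linear.continuous_on[OF bounded_linear_scaleC]
      continuous_intros)

lemma poly_eval_unitary_conj:
  fixes a u :: "'a::unital_cstar_algebra"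
  assumes "unitary u"
  shows "poly_eval p (star u * a * u) = star u * poly_eval p a * u"
proof (induction p)
  case (pCons z p)
  have u: "star u * u = 1" "u * star u = 1" using assms by (simp_all add: unitary_def)
  have "star u * a * u * (star u * poly_eval p a * u)
      = star u * a * (u * star u) * poly_eval p a * u"
    by (simp only: mult.assoc)
  also have "\<dots> = star u * (a * poly_eval p a) * u"
    by (simp add: u mult.assoc)
  finally show ?case using pCons u
    by (simp add: poly_eval_pCons distrib_left distrib_right mult_scaleC_left mult_scaleC_right)
qed simp

lemma sa_roots_unitary_conj:
  assumes "unitary u" "a \<in> sa_roots p"
  shows "star u * a * u \<in> sa_roots p"
  using assms poly_eval_unitary_conj[OF assms(1), of p a]
  by (simp add: sa_roots_def self_adjoint_def star_mult star_star mult.assoc)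

section \<open>Intertwiners from Lagrange interpolation\<close>

definition lagrange_basis :: "'i set \<Rightarrow> ('i \<Rightarrow> complex) \<Rightarrow> 'i \<Rightarrow> complex poly" where
  "lagrange_basis I lam i =
     smult (inverse (\<Prod>j\<in>I - {i}. lam i - lam j)) (\<Prod>j\<in>I - {i}. [:- lam j, 1:])"

lemma poly_lagrange_basis:
  assumes "finite I" "inj_on lam I" "i \<in> I" "k \<in> I"
  shows "poly (lagrange_basis I lam i) (lam k) = (if i = k then 1 else 0)"
proof (cases "i = k")
  case True
  have "(\<Prod>j\<in>I - {k}. lam k - lam j) \<noteq> 0"
    using assms by (auto simp: inj_on_def)
  then show ?thesis using True by (simp add: lagrange_basis_def poly_prod)
next
  case False
  then show ?thesis using assms by (auto simp: lagrange_basis_def poly_prod)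
qed

text \<open>
  Both sides have degree less than the number of nodes and agree at every node.
\<close>

lemma sum_lagrange_basis:
  assumes "finite I" "inj_on lam I" "I \<noteq> {}"
  shows "(\<Sum>i\<in>I. lagrange_basis I lam i) = 1"
proof (rule poly_eqI_degree[of "lam ` I"])
  have c: "card (lam ` I) = card I" "card I > 0"
    using assms by (auto simp: card_image card_gt_0_iff)
  have "degree (lagrange_basis I lam i) \<le> card I - 1" if "i \<in> I" for i
  proof -
    have "degree (\<Prod>j\<in>I - {i}. [:- lam j, 1:]) \<le> (\<Sum>j\<in>I - {i}. degree [:- lam j, 1:])"
      using degree_prod_sum_le[of "I - {i}" "\<lambda>j. [:- lam j, 1:]"] assms(1) by (simp add: comp_def)
    then show ?thesis
      using that assms(1) order_trans[OF degree_smult_le] by (auto simp: lagrange_basis_def)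
  qed
  then have "degree (\<Sum>i\<in>I. lagrange_basis I lam i) \<le> card I - 1"
    using assms(1) by (intro degree_sum_le) auto
  then show "degree (\<Sum>i\<in>I. lagrange_basis I lam i) < card (lam ` I)" using c by linarith
  show "degree (1 :: complex poly) < card (lam ` I)" using c by simp
next
  fix x assume "x \<in> lam ` I"
  then show "poly (\<Sum>i\<in>I. lagrange_basis I lam i) x = poly 1 x"
    using assms(1,2) by (auto simp: poly_sum poly_lagrange_basis)
qed

text \<open>
  The product of \<open>\<lambda> - \<lambda>\<^sub>i\<close> and the \<open>i\<close>-th basis polynomial is a scalar multiple of the full product,
  which vanishes at \<open>a\<close>.
\<close>

lemma lagrange_basis_eigen:
  fixes a :: "'a::unital_cstar_algebra"
  assumes "finite I" "i \<in> I" "poly_eval (\<Prod>i\<in>I. [:- lam i, 1:]) a = 0"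
  shows "a * poly_eval (lagrange_basis I lam i) a = lam i *\<^sub>C poly_eval (lagrange_basis I lam i) a"
    and "poly_eval (lagrange_basis I lam i) a * a = lam i *\<^sub>C poly_eval (lagrange_basis I lam i) a"
proof -
  let ?L = "lagrange_basis I lam i"
  define z where "z = inverse (\<Prod>j\<in>I - {i}. lam i - lam j)"
  have "[:- lam i, 1:] * ?L = smult z (\<Prod>i\<in>I. [:- lam i, 1:])"
    unfolding lagrange_basis_def z_def prod.remove[OF assms(1,2)] by simp
  then have L: "poly_eval ([:- lam i, 1:] * ?L) a = 0"
    using assms(3) by (simp only: poly_eval_smult scaleC_zero_right)
  show "a * poly_eval ?L a = lam i *\<^sub>C poly_eval ?L a"
    using L unfolding poly_eval_mult
    by (simp add: poly_eval_pCons scaleC_minus_left mult_scaleC_left algebra_simps)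
  show "poly_eval ?L a * a = lam i *\<^sub>C poly_eval ?L a"
    using L unfolding mult.commute[of "[:- lam i, 1:]"] poly_eval_mult
    by (simp add: poly_eval_pCons scaleC_minus_left mult_scaleC_right algebra_simps)
qed

lemma poly_eval_eigen:
  fixes a e :: "'a::unital_cstar_algebra"
  assumes "a * e = z *\<^sub>C e"
  shows "poly_eval q a * e = poly q z *\<^sub>C e"
  by (induction q) (simp_all add: poly_eval_pCons algebra_simps mult_scaleC_left mult_scaleC_right
      scaleC_add_left scaleC_scaleC assms)

definition lagrange_intertwiner ::
    "'i set \<Rightarrow> ('i \<Rightarrow> complex) \<Rightarrow> 'a::unital_cstar_algebra \<Rightarrow> 'a \<Rightarrow> 'a" where
  "lagrange_intertwiner I lam y x =
     (\<Sum>i\<in>I. poly_eval (lagrange_basis I lam i) y * poly_eval (lagrange_basis I lam i) x)"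

text \<open>
  In each summand \<open>y\<close> acts from the left as \<open>\<lambda>\<^sub>i\<close>, and so does \<open>x\<close> from the right.
\<close>

lemma lagrange_intertwiner_intertwines:
  fixes x y :: "'a::unital_cstar_algebra"
  assumes "finite I" "poly_eval (\<Prod>i\<in>I. [:- lam i, 1:]) x = 0"
    "poly_eval (\<Prod>i\<in>I. [:- lam i, 1:]) y = 0"
  shows "y * lagrange_intertwiner I lam y x = lagrange_intertwiner I lam y x * x"
  unfolding lagrange_intertwiner_def sum_distrib_left sum_distrib_right
proof (rule sum.cong)
  fix i assume "i \<in> I"
  let ?f = "poly_eval (lagrange_basis I lam i)"
  have "y * (?f y * ?f x) = (y * ?f y) * ?f x" by (simp only: mult.assoc)
  also have "\<dots> = ?f y * (?f x * x)"
    using lagrange_basis_eigen(1)[OF assms(1) \<open>i \<in> I\<close> assms(3)]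
      lagrange_basis_eigen(2)[OF assms(1) \<open>i \<in> I\<close> assms(2)]
    by (simp add: mult_scaleC_left mult_scaleC_right)
  finally show "y * (?f y * ?f x) = ?f y * ?f x * x" by (simp only: mult.assoc)
qed simp

text \<open>
  The elements \<open>L\<^sub>i(x)\<close> are idempotent: \<open>x\<close> acts on \<open>L\<^sub>i(x)\<close> as \<open>\<lambda>\<^sub>i\<close>, hence \<open>L\<^sub>i(x)\<close> acts on it as
  \<open>L\<^sub>i(\<lambda>\<^sub>i) = 1\<close>. The sum therefore collapses to \<open>\<Sum>\<^sub>i L\<^sub>i(x) = 1\<close>.
\<close>

lemma lagrange_intertwiner_same:
  fixes x :: "'a::unital_cstar_algebra"
  assumes "finite I" "inj_on lam I" "I \<noteq> {}" "poly_eval (\<Prod>i\<in>I. [:- lam i, 1:]) x = 0"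
  shows "lagrange_intertwiner I lam x x = 1"
proof -
  let ?f = "\<lambda>i. poly_eval (lagrange_basis I lam i) x"
  have "?f i * ?f i = ?f i" if "i \<in> I" for i
    using poly_eval_eigen[OF lagrange_basis_eigen(1)[OF assms(1) that assms(4)]]
    by (simp add: poly_lagrange_basis assms that)
  then have "lagrange_intertwiner I lam x x = (\<Sum>i\<in>I. ?f i)"
    by (simp add: lagrange_intertwiner_def)
  also have "\<dots> = 1"
    using sum_lagrange_basis[OF assms(1-3)] by (simp flip: poly_eval_sum)
  finally show ?thesis .
qed

lemma intertwiner_near_one:
  fixes b :: "'a::unital_cstar_algebra"
  assumes "finite I" "inj_on lam I" "I \<noteq> {}" and p: "p = (\<Prod>i\<in>I. [:- lam i, 1:])"
    and b: "poly_eval p b = 0" and "\<epsilon> > 0"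
  obtains \<delta> where "\<delta> > 0"
    "\<And>x y. \<lbrakk>poly_eval p x = 0; poly_eval p y = 0; dist b x < \<delta>; dist b y < \<delta>\<rbrakk>
       \<Longrightarrow> \<exists>v. y * v = v * x \<and> norm (v - 1) < \<epsilon>"
proof -
  let ?v = "\<lambda>z. lagrange_intertwiner I lam (fst z) (snd z)"
  have "continuous_on UNIV ?v"
    unfolding lagrange_intertwiner_def
    by (intro continuous_intros continuous_on_compose2[OF continuous_poly_eval]) auto
  then obtain d where d: "d > 0" "\<And>z. dist z (b, b) < d \<Longrightarrow> dist (?v z) (?v (b, b)) < \<epsilon>"
    using \<open>\<epsilon> > 0\<close> unfolding continuous_on_iff by (metis UNIV_I)
  have one: "?v (b, b) = 1"
    using lagrange_intertwiner_same[of I lam b] assms by simp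
  show ?thesis
  proof (rule that[of "d / 2"])
    fix x y assume *: "poly_eval p x = 0" "poly_eval p y = 0" "dist b x < d / 2" "dist b y < d / 2"
    have "dist (y, x) (b, b) \<le> dist y b + dist x b"
      unfolding dist_Pair_Pair by (rule sqrt_sum_squares_le_sum) auto
    then have "dist (?v (y, x)) (?v (b, b)) < \<epsilon>"
      using * by (intro d) (simp add: dist_commute)
    then show "\<exists>v. y * v = v * x \<and> norm (v - 1) < \<epsilon>"
      using * lagrange_intertwiner_intertwines[of I lam x y] assms(1) p one
      by (auto simp: dist_norm)
  qed (use d in simp)
qed

section \<open>The conjugation paths\<close>

lemma unitary_exp_skew:
  fixes z :: "'a::unital_cstar_algebra"
  assumes "star z = - z"
  shows "unitary (exp z)" "star (exp z) = exp (- z)"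
  using assms exp_minus_inverse[of z] exp_minus_inverse[of "- z"]
  by (simp_all add: unitary_def star_exp)

lemma star_i_scaleC: "self_adjoint c \<Longrightarrow> star (\<i> *\<^sub>C c) = - (\<i> *\<^sub>C c)"
  by (simp add: star_scaleC self_adjoint_def scaleC_minus_left)

lemma exp_path_eq:
  "exp_path a c t = exp (- (t *\<^sub>R \<i> *\<^sub>C c)) * a * exp (t *\<^sub>R \<i> *\<^sub>C c)"
  by (simp add: exp_path_def scaleC_minus_left mult.commute[of \<i>]
      flip: scaleC_of_real scaleC_scaleC)

lemma exp_path_0 [simp]: "exp_path a c 0 = a"
  by (simp add: exp_path_eq)

lemma exp_path_scaled: "exp_path a (s *\<^sub>R c) t = exp_path a c (s * t)"
  by (simp add: exp_path_def scaleC_scaleC mult_ac flip: scaleC_of_real)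

text \<open>
  The paths are orbits of a one-parameter group of conjugations. This reduces expansions at any
  time to expansions at time \<open>0\<close>.
\<close>

lemma exp_path_shift: "exp_path a c (s + t) = exp_path (exp_path a c s) c t"
proof -
  let ?y = "\<i> *\<^sub>C c"
  have "exp ((s + t) *\<^sub>R ?y) = exp (s *\<^sub>R ?y) * exp (t *\<^sub>R ?y)"
    unfolding scaleR_add_left by (rule exp_add_commuting) (simp add: mult.commute)
  moreover have "exp (- ((s + t) *\<^sub>R ?y)) = exp (- (t *\<^sub>R ?y)) * exp (- (s *\<^sub>R ?y))"
  proof -
    have "- ((s + t) *\<^sub>R ?y) = - (t *\<^sub>R ?y) + - (s *\<^sub>R ?y)"
      by (simp add: scaleR_add_left)
    then have "exp (- ((s + t) *\<^sub>R ?y)) = exp (- (t *\<^sub>R ?y) + - (s *\<^sub>R ?y))"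
      by (rule arg_cong)
    also have "\<dots> = exp (- (t *\<^sub>R ?y)) * exp (- (s *\<^sub>R ?y))"
      by (rule exp_add_commuting) (simp add: mult.commute)
    finally show ?thesis .
  qed
  ultimately show ?thesis by (simp add: exp_path_eq mult.assoc)
qed

lemma exp_path_unitary_conj:
  assumes "self_adjoint c"
  shows "unitary (exp (t *\<^sub>R \<i> *\<^sub>C c))"
    and "exp_path a c t = star (exp (t *\<^sub>R \<i> *\<^sub>C c)) * a * exp (t *\<^sub>R \<i> *\<^sub>C c)"
proof -
  have "star (t *\<^sub>R \<i> *\<^sub>C c) = - (t *\<^sub>R \<i> *\<^sub>C c)"
    using assms by (simp add: star_scaleR star_i_scaleC)
  from unitary_exp_skew[OF this] show "unitary (exp (t *\<^sub>R \<i> *\<^sub>C c))"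
    "exp_path a c t = star (exp (t *\<^sub>R \<i> *\<^sub>C c)) * a * exp (t *\<^sub>R \<i> *\<^sub>C c)"
    by (simp_all add: exp_path_eq)
qed

lemma exp_path_in_sa_roots:
  assumes "self_adjoint c" "a \<in> sa_roots p"
  shows "exp_path a c t \<in> sa_roots p"
  using sa_roots_unitary_conj[OF exp_path_unitary_conj(1) assms(2)] exp_path_unitary_conj(2) assms(1)
  by metis

text \<open>
  With \<open>u = e\<^sup>i\<^sup>t\<^sup>c\<close> the difference is \<open>u\<^sup>* [a, u - 1]\<close>, so its norm is at most \<open>2 \<parallel>a\<parallel> \<parallel>u - 1\<parallel>\<close>; and
  \<open>\<parallel>u - 1\<parallel> \<le> exp 1 \<parallel>c\<parallel> \<le> 3 \<parallel>c\<parallel>\<close>.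
\<close>

lemma norm_exp_path_diff_le:
  fixes a c :: "'a::unital_cstar_algebra"
  assumes "self_adjoint c" "norm c \<le> 1" "0 \<le> t" "t \<le> 1"
  shows "norm (exp_path a c t - a) \<le> 6 * norm a * norm c"
proof -
  define z where "z = t *\<^sub>R \<i> *\<^sub>C c"
  define u where "u = exp z"
  have u: "unitary u" "exp_path a c t = star u * a * u"
    unfolding u_def z_def using exp_path_unitary_conj assms(1) by blast+
  have z: "norm z \<le> norm c"
    using assms(2-4) mult_left_le_one_le[of "norm c" t] by (simp add: z_def norm_scaleC)
  have "norm (u - 1) \<le> exp (norm z) * norm z"
    unfolding u_def by (rule norm_exp_minus_one_le)
  also have "\<dots> \<le> 3 * norm c"
  proof (rule mult_mono)
    have "exp (norm z) \<le> exp 1" using z assms(2) by simp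
    then show "exp (norm z) \<le> 3" using exp_le by linarith
  qed (use z in auto)
  finally have u1: "norm (u - 1) \<le> 3 * norm c" .
  have "exp_path a c t - a = star u * (a * (u - 1) - (u - 1) * a)"
  proof -
    have "star u * (u * a) = a" using u(1) by (simp add: unitary_def flip: mult.assoc)
    then show ?thesis by (simp add: u(2) algebra_simps)
  qed
  also have "norm \<dots> \<le> norm (star u) * norm (a * (u - 1) - (u - 1) * a)"
    by (rule norm_mult_ineq)
  also have "\<dots> = norm (a * (u - 1) - (u - 1) * a)"
    using u(1) by (simp add: norm_star norm_unitary)
  also have "\<dots> \<le> norm a * norm (u - 1) + norm (u - 1) * norm a"
    by (intro order_trans[OF norm_triangle_ineq4] add_mono norm_mult_ineq)
  also have "\<dots> = 2 * norm a * norm (u - 1)" by simp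
  also have "\<dots> \<le> 2 * norm a * (3 * norm c)"
    by (intro mult_left_mono u1) auto
  finally show ?thesis by simp
qed

text \<open>
  The coefficients come from the Cauchy product of the two exponential series, with \<open>a\<close> absorbed
  into the left one.
\<close>

lemma exp_path_sums:
  fixes a c :: "'a::unital_cstar_algebra"
  obtains b where "\<And>t. (\<lambda>k. t ^ k *\<^sub>R b k) sums exp_path a c t"
proof -
  define y where "y = \<i> *\<^sub>C c"
  define b where
    "b = (\<lambda>k. \<Sum>i\<le>k. ((- y) ^ i /\<^sub>R fact i * a) * (y ^ (k - i) /\<^sub>R fact (k - i)))"
  have "(\<lambda>k. t ^ k *\<^sub>R b k) sums exp_path a c t" for t
  proof -
    let ?f = "\<lambda>i. (- (t *\<^sub>R y)) ^ i /\<^sub>R fact i * a" and ?g = "\<lambda>i. (t *\<^sub>R y) ^ i /\<^sub>R fact i"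
    have "summable (\<lambda>i. norm (?f i))"
    proof (rule summable_comparison_test'[where N = 0])
      show "summable (\<lambda>i. norm ((- (t *\<^sub>R y)) ^ i /\<^sub>R fact i) * norm a)"
        by (intro summable_mult2 summable_norm_exp)
    qed (use norm_mult_ineq in simp)
    then have "(\<lambda>k. \<Sum>i\<le>k. ?f i * ?g (k - i)) sums (suminf ?f * suminf ?g)"
      by (rule Cauchy_product_sums) (rule summable_norm_exp)
    moreover have "suminf ?f = exp (- (t *\<^sub>R y)) * a"
      by (rule sums_unique[symmetric, OF sums_mult2[OF exp_converges]])
    moreover have "suminf ?g = exp (t *\<^sub>R y)"
      by (rule sums_unique[symmetric, OF exp_converges])
    moreover have "(\<Sum>i\<le>k. ?f i * ?g (k - i)) = t ^ k *\<^sub>R b k" for k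
      unfolding b_def scaleR_sum_right
    proof (rule sum.cong)
      fix i assume "i \<in> {..k}"
      then have "t ^ k = t ^ i * t ^ (k - i)" by (simp flip: power_add)
      moreover have "(- (t *\<^sub>R y)) ^ i = t ^ i *\<^sub>R (- y) ^ i"
        by (simp only: scaleR_minus_right[symmetric] scaleR_power)
      ultimately show "?f i * ?g (k - i) =
          t ^ k *\<^sub>R (((- y) ^ i /\<^sub>R fact i * a) * (y ^ (k - i) /\<^sub>R fact (k - i)))"
        by (simp add: mult_ac)
    qed simp
    ultimately show ?thesis by (simp add: exp_path_eq y_def)
  qed
  then show ?thesis by (rule that)
qed

lemma real_analytic_on_exp_path: "real_analytic_on (exp_path a c) T"
  unfolding real_analytic_on_def
proof
  fix s
  obtain b where b: "\<And>t. (\<lambda>k. t ^ k *\<^sub>R b k) sums exp_path (exp_path a c s) c t"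
    using exp_path_sums by blast
  have "(\<lambda>k. (t - s) ^ k *\<^sub>R b k) sums exp_path a c t" for t
    using b[of "t - s"] by (simp flip: exp_path_shift)
  then show "\<exists>r>0. \<exists>b. \<forall>t\<in>T. \<bar>t - s\<bar> < r \<longrightarrow> (\<lambda>k. (t - s) ^ k *\<^sub>R b k) sums exp_path a c t"
    using zero_less_one by blast
qed

lemma continuous_on_exp_path: "continuous_on T (exp_path a c)"
proof -
  have exp: "continuous_on T (\<lambda>t. exp (t *\<^sub>R z))" for z :: 'a
    by (rule continuous_on_vector_derivative) (rule exp_scaleR_has_vector_derivative_right)
  have "continuous_on T (\<lambda>t. exp (t *\<^sub>R (- (\<i> *\<^sub>C c))) * a * exp (t *\<^sub>R \<i> *\<^sub>C c))"
    by (intro continuous_intros exp)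
  then show ?thesis by (simp add: exp_path_eq[abs_def])
qed

section \<open>Nearby elements are unitarily equivalent\<close>

text \<open>
  Polar decomposition followed by a logarithm. With \<open>\<eta> = \<parallel>v - 1\<parallel>\<close> each passage from \<open>g\<close> to
  its logarithm at most doubles the distance from \<open>1\<close>. This produces the chain of bounds
  \<open>\<parallel>v\<^sup>* v - 1\<parallel> \<le> 3 \<eta>\<close>, \<open>\<parallel>h\<parallel> \<le> 6 \<eta>\<close>, \<open>\<parallel>u - 1\<parallel> \<le> 10 \<eta>\<close>, \<open>\<parallel>z\<parallel> \<le> 20 \<eta>\<close>; for \<open>\<eta> \<le> 1/80\<close> all
  elements stay where \<open>exp\<close> is injective and logarithms exist.
\<close>

lemma similar_imp_exp_path:
  fixes x y v :: "'a::unital_cstar_algebra"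
  assumes sa: "self_adjoint x" "self_adjoint y" and yv: "y * v = v * x"
    and small: "norm (v - 1) \<le> 1/80"
  obtains c where "self_adjoint c" "norm c \<le> 20 * norm (v - 1)" "exp_path x c 1 = y"
proof -
  define \<eta> where "\<eta> = norm (v - 1)"
  have \<eta>: "0 \<le> \<eta>" "\<eta> \<le> 1/80" using small by (auto simp: \<eta>_def)
  have nv: "norm v \<le> 2"
    using norm_triangle_sub[of v 1] \<eta> by (simp add: \<eta>_def)
  \<comment> \<open>Writing \<open>v\<close> as an exponential exhibits it as invertible.\<close>
  obtain w where w: "exp w = v" using small_log_exists[of v] small by force
  define g where "g = star v * v"
  have "g - 1 = star v * (v - 1) + star (v - 1)"
    by (simp add: g_def star_diff algebra_simps)
  also have "norm \<dots> \<le> norm (star v) * norm (v - 1) + norm (star (v - 1))"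
    by (intro norm_triangle_le add_mono norm_mult_ineq order_refl)
  also have "\<dots> \<le> 2 * \<eta> + \<eta>"
    unfolding norm_star \<eta>_def[symmetric] using nv \<eta> by (intro add_mono mult_right_mono) auto
  finally have g1: "norm (g - 1) \<le> 3 * \<eta>" by simp
  obtain h where h: "exp h = g" "norm h \<le> 2 * norm (g - 1)"
    and hcomm: "\<And>y. g * y = y * g \<Longrightarrow> h * y = y * h"
  proof -
    have "norm (g - 1) \<le> 1/8" using g1 \<eta> by linarith
    then show thesis using small_log_exists[of g] that by metis
  qed
  have nh: "norm h \<le> 6 * \<eta>" using h(2) g1 by simp
  \<comment> \<open>The adjoint of a small logarithm of \<open>g = star g\<close> is another one, so the two coincide.\<close>
  have "exp (star h) = exp h"
    by (simp add: star_exp[symmetric] h(1)) (simp add: g_def star_mult star_star)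
  then have sh: "star h = h"
    by (rule exp_inj_small[rotated 2]) (use nh \<eta> in \<open>simp_all add: norm_star\<close>)
  \<comment> \<open>Taking adjoints of \<open>y v = v x\<close> shows that \<open>v\<^sup>*\<close> intertwines in the opposite direction.\<close>
  have vy: "star v * y = x * star v"
    using arg_cong[OF yv, of star] sa by (simp add: star_mult self_adjoint_def)
  have "g * x = x * g"
    unfolding g_def by (metis mult.assoc vy yv)
  then have hx: "h * x = x * h" by (rule hcomm)
  \<comment> \<open>\<open>exp k\<close> serves as \<open>(v\<^sup>* v)\<^bsup>-1/2\<^esup>\<close>.\<close>
  define k where "k = (- 1/2) *\<^sub>R h"
  have k: "star k = k" "k * x = x * k" "norm k \<le> 3 * \<eta>"
    using nh by (simp_all add: k_def star_minus star_scaleR sh hx)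
  have gk: "exp k * g * exp k = 1"
  proof -
    have "- k + - k = h" by (simp add: k_def flip: scaleR_add_left)
    then have "g = exp (- k) * exp (- k)"
      by (metis h(1) exp_add_commuting)
    then have "exp k * g * exp k = (exp k * exp (- k)) * (exp (- k) * exp (- (- k)))"
      by (simp add: mult.assoc)
    then show ?thesis by (simp only: exp_minus_inverse mult_1)
  qed
  define u where "u = v * exp k"
  have uu: "star u * u = 1"
    using gk by (simp add: u_def star_mult star_exp k(1) g_def mult.assoc)
  \<comment> \<open>The isometry \<open>u\<close> has a right inverse, which then must be \<open>star u\<close>.\<close>
  have "u * (exp (- k) * exp (- w)) = v * (exp k * exp (- k)) * exp (- w)"
    by (simp only: u_def mult.assoc)
  also have "\<dots> = 1"
    by (simp add: exp_minus_inverse) (simp add: exp_minus_inverse flip: w)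
  finally have "u * star u = 1"
    using uu by (metis mult.assoc mult_1_left mult_1_right)
  with uu have uni: "star u * u = 1" "u * star u = 1" by auto
  have "norm (exp k - 1) \<le> 3/2 * norm k"
    using exp_half_Lipschitz[of k 0] k(3) \<eta> norm_triangle_sub[of "exp k - 1" k]
    by (simp add: algebra_simps)
  then have k1: "norm (exp k - 1) \<le> 9/2 * \<eta>" using k(3) by simp
  have "u - 1 = v * (exp k - 1) + (v - 1)"
    by (simp add: u_def algebra_simps)
  also have "norm \<dots> \<le> norm v * norm (exp k - 1) + norm (v - 1)"
    by (intro norm_triangle_le add_mono norm_mult_ineq order_refl)
  also have "\<dots> \<le> 2 * (9/2 * \<eta>) + \<eta>"
    unfolding \<eta>_def[symmetric] using nv k1 by (intro add_mono mult_mono) auto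
  finally have u1: "norm (u - 1) \<le> 10 * \<eta>" by simp
  then have "norm (u - 1) \<le> 1/8" using \<eta> by simp
  then obtain z where z: "exp z = u" "norm z \<le> 2 * norm (u - 1)"
    using small_log_exists by metis
  have nz: "norm z \<le> 20 * \<eta>" using z(2) u1 by simp
  \<comment> \<open>Both \<open>star z\<close> and \<open>- z\<close> are small logarithms of \<open>star u\<close>.\<close>
  have "exp (- z) = star u"
    using exp_minus_inverse[of z] uni(1) z(1) by (metis mult.assoc mult_1_left mult_1_right)
  then have "exp (star z) = exp (- z)" by (simp add: star_exp[symmetric] z(1))
  then have sz: "star z = - z"
    by (rule exp_inj_small[rotated 2]) (use nz \<eta> in \<open>simp_all add: norm_star\<close>)
  have "y * u = u * x"
    using yv exp_commute[OF k(2)] by (simp add: u_def mult.assoc) (simp flip: mult.assoc)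
  then have y: "u * x * star u = y" using uni(2) by (metis mult.assoc mult_1_right)
  define c where "c = \<i> *\<^sub>C z"
  have ic: "\<i> *\<^sub>C c = - z"
    by (simp add: c_def scaleC_scaleC scaleC_minus_left)
  show ?thesis
  proof (rule that[of c])
    show "self_adjoint c"
      using sz by (simp add: c_def self_adjoint_def star_scaleC scaleC_minus_left
          linear_neg[OF bounded_linear.linear[OF bounded_linear_scaleC]])
    show "norm c \<le> 20 * norm (v - 1)"
      using nz by (simp add: c_def norm_scaleC \<eta>_def)
    show "exp_path x c 1 = y"
      using y z(1) \<open>exp (- z) = star u\<close> by (simp add: exp_path_eq ic)
  qed
qed

text \<open>
  For given \<open>b\<close> and \<open>\<epsilon>\<close> a single \<open>\<delta>\<close> serves for all pairs \<open>x\<close>, \<open>y\<close> near \<open>b\<close>. Local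
  connectedness needs this uniformity; the case \<open>x = b\<close> is the similarity of a root with its
  neighbours.
\<close>

lemma nearby_joined_by_small_exp_path:
  fixes b :: "'a::unital_cstar_algebra"
  assumes I: "finite I" "inj_on lam I" "I \<noteq> {}" and p: "p = (\<Prod>i\<in>I. [:- lam i, 1:])"
    and b: "b \<in> sa_roots p" and "\<epsilon> > 0"
  obtains \<delta> where "\<delta> > 0"
    "\<And>x y. \<lbrakk>x \<in> sa_roots p; y \<in> sa_roots p; dist b x < \<delta>; dist b y < \<delta>\<rbrakk>
       \<Longrightarrow> \<exists>c. self_adjoint c \<and> norm c < \<epsilon> \<and> exp_path x c 1 = y \<and>
             (\<forall>t\<in>{0..1}. exp_path x c t \<in> sa_roots p \<and> dist b (exp_path x c t) < \<epsilon>)"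
proof -
  \<comment> \<open>A bound for \<open>norm c\<close> that keeps the path within \<open>6 (norm b + 1) \<kappa> \<le> \<epsilon> / 2\<close> of \<open>x\<close>.\<close>
  define \<kappa> where "\<kappa> = min (min 1 \<epsilon>) (\<epsilon> / (12 * (norm b + 1)))"
  have nb: "norm b + 1 > 0" by (simp add: add_nonneg_pos)
  have \<kappa>: "\<kappa> > 0" "\<kappa> \<le> 1" "\<kappa> \<le> \<epsilon>" "\<kappa> \<le> \<epsilon> / (12 * (norm b + 1))"
    using \<open>\<epsilon> > 0\<close> nb by (auto simp: \<kappa>_def)
  then have \<kappa>': "6 * (norm b + 1) * \<kappa> \<le> \<epsilon> / 2"
    using nb by (simp add: field_simps)
  obtain d where d: "d > 0"
    "\<And>x y. \<lbrakk>poly_eval p x = 0; poly_eval p y = 0; dist b x < d; dist b y < d\<rbrakk>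
       \<Longrightarrow> \<exists>v. y * v = v * x \<and> norm (v - 1) < \<kappa> / 80"
    using intertwiner_near_one[OF I p, of b "\<kappa> / 80"] b \<kappa>(1) by (auto simp: sa_roots_def)
  show ?thesis
  proof (rule that[of "min d (min 1 (\<epsilon> / 2))"])
    fix x y assume x: "x \<in> sa_roots p" "dist b x < min d (min 1 (\<epsilon> / 2))"
      and y: "y \<in> sa_roots p" "dist b y < min d (min 1 (\<epsilon> / 2))"
    obtain v where v: "y * v = v * x" "norm (v - 1) < \<kappa> / 80"
      using d(2)[of x y] x y by (auto simp: sa_roots_def)
    then obtain c where c: "self_adjoint c" "norm c \<le> 20 * norm (v - 1)" "exp_path x c 1 = y"
      using similar_imp_exp_path[of x y v] x y \<kappa>(2) by (auto simp: sa_roots_def)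
    have nc: "norm c < \<kappa>" using c(2) v(2) \<kappa>(1) by simp
    have "dist b (exp_path x c t) < \<epsilon>" if "t \<in> {0..1}" for t
    proof -
      have nx: "norm x \<le> norm b + 1"
        using x(2) norm_triangle_sub[of x b] by (simp add: dist_norm norm_minus_commute)
      have "norm (exp_path x c t - x) \<le> 6 * norm x * norm c"
        using c(1) nc \<kappa>(2) that by (intro norm_exp_path_diff_le) auto
      also have "\<dots> \<le> 6 * (norm b + 1) * \<kappa>"
        using nx nc nb by (intro mult_mono) auto
      finally have "dist x (exp_path x c t) \<le> \<epsilon> / 2"
        using \<kappa>' by (simp add: dist_norm norm_minus_commute)
      then show ?thesis using x(2) dist_triangle[of b "exp_path x c t" x] by simp
    qed
    then show "\<exists>c. self_adjoint c \<and> norm c < \<epsilon> \<and> exp_path x c 1 = y \<and>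
        (\<forall>t\<in>{0..1}. exp_path x c t \<in> sa_roots p \<and> dist b (exp_path x c t) < \<epsilon>)"
      using c nc \<kappa>(3) exp_path_in_sa_roots[OF c(1) x(1)] by (intro exI[of _ c]) auto
  qed (use d(1) \<open>\<epsilon> > 0\<close> in auto)
qed

section \<open>Local connectedness of the components\<close>

lemma locally_exp_path_connected_imp_locally_path_connected:
  assumes "locally_exp_path_connected K"
  shows "locally path_connected K"
  unfolding locally_def
proof (intro allI impI)
  fix W b assume "openin (top_of_set K) W \<and> b \<in> W"
  then obtain U V where UV: "openin (top_of_set K) U" "b \<in> U" "U \<subseteq> V" "V \<subseteq> W"
    and V: "\<And>x. x \<in> V \<Longrightarrow> exp_joined V b x"
    using assms unfolding locally_exp_path_connected_def by meson
  have "path_component V b x" if "x \<in> V" for x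
  proof -
    from V[OF that] obtain c where "exp_path b c 1 = x" "\<forall>t\<in>{0..1}. exp_path b c t \<in> V"
      by (auto simp: exp_joined_def)
    then show ?thesis
      unfolding path_component_def
      by (intro exI[of _ "exp_path b c"])
         (auto simp: path_def path_image_def pathstart_def pathfinish_def continuous_on_exp_path)
  qed
  then have "path_connected V"
    unfolding path_connected_component by (meson path_component_sym path_component_trans)
  then show "\<exists>U V. openin (top_of_set K) U \<and> path_connected V \<and> b \<in> U \<and> U \<subseteq> V \<and> V \<subseteq> W"
    using UV by blast
qed

text \<open>
  The whole path is a connected subset of the set of roots and meets the component in \<open>b\<close>.
\<close>

lemma exp_path_in_component:
  assumes "self_adjoint c" "b \<in> connected_component_set (sa_roots p) a"
  shows "exp_path b c t \<in> connected_component_set (sa_roots p) a"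
proof -
  have "b \<in> sa_roots p" using assms(2) connected_component_subset by blast
  then have "range (exp_path b c) \<subseteq> connected_component_set (sa_roots p) b"
    using assms(1)
    by (intro connected_component_maximal connected_continuous_image continuous_on_exp_path)
       (auto intro: exp_path_in_sa_roots image_eqI[of _ _ 0])
  then show ?thesis using connected_component_eq[OF assms(2)] by blast
qed

text \<open>
  \<open>V\<close> is the set of end points of exponential paths from \<open>b\<close> with generator of norm less than \<open>\<eta>\<close>.
  Rescaling the generator keeps such paths inside \<open>V\<close>. All roots within some distance \<open>d\<close> of \<open>b\<close>
  lie in \<open>V\<close>, and \<open>e\<close> is chosen such that any two roots within \<open>e\<close> of \<open>b\<close> are joined by a path
  staying within \<open>d\<close> of \<open>b\<close>, hence inside \<open>V\<close>.
\<close>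

lemma components_locally_exp_path_connected:
  fixes a :: "'a::unital_cstar_algebra"
  assumes I: "finite I" "inj_on lam I" "I \<noteq> {}" and p: "p = (\<Prod>i\<in>I. [:- lam i, 1:])"
  shows "locally_exp_path_connected (connected_component_set (sa_roots p) a)"
  unfolding locally_exp_path_connected_def
proof (intro allI impI)
  let ?K = "connected_component_set (sa_roots p) a"
  fix W b assume Wb: "openin (top_of_set ?K) W \<and> b \<in> W"
  then have bK: "b \<in> ?K" using openin_imp_subset by blast
  have KS: "?K \<subseteq> sa_roots p" by (rule connected_component_subset)
  then have bS: "b \<in> sa_roots p" using bK by blast
  obtain r where r: "r > 0" "ball b r \<inter> ?K \<subseteq> W"
    using conjunct1[OF Wb] conjunct2[OF Wb] unfolding openin_contains_ball by (meson bspec)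
  \<comment> \<open>Makes \<open>6 norm b \<eta> < r\<close>; the summand \<open>1\<close> in the denominator covers \<open>b = 0\<close>.\<close>
  define \<eta> where "\<eta> = min 1 (r / (6 * norm b + 1))"
  have nb: "6 * norm b + 1 > 0" by (simp add: add_nonneg_pos)
  have \<eta>: "\<eta> > 0" "\<eta> \<le> 1" "\<eta> \<le> r / (6 * norm b + 1)" using r(1) nb by (auto simp: \<eta>_def)
  define V where "V = {exp_path b c 1 | c. self_adjoint c \<and> norm c < \<eta>}"
  have path_V: "exp_path b c t \<in> V" if "self_adjoint c" "norm c < \<eta>" "t \<in> {0..1}" for c t
  proof -
    have "norm (t *\<^sub>R c) \<le> norm c"
      using that(3) mult_left_le_one_le[of "norm c" t] by simp
    then have "norm (t *\<^sub>R c) < \<eta>" using that(2) by simp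
    moreover have "self_adjoint (t *\<^sub>R c)"
      using that(1) by (simp add: self_adjoint_def star_scaleR)
    moreover have "exp_path b c t = exp_path b (t *\<^sub>R c) 1"
      by (simp add: exp_path_scaled)
    ultimately show ?thesis unfolding V_def by blast
  qed
  have VW: "V \<subseteq> W"
  proof
    fix x assume "x \<in> V"
    then obtain c where c: "self_adjoint c" "norm c < \<eta>" "x = exp_path b c 1"
      by (auto simp: V_def)
    have "norm (x - b) \<le> 6 * norm b * norm c"
      unfolding c(3) using c \<eta>(2) by (intro norm_exp_path_diff_le) auto
    also have "\<dots> \<le> 6 * norm b * \<eta>" using c(2) by (intro mult_left_mono) auto
    also have "\<dots> < (6 * norm b + 1) * \<eta>" using \<eta>(1) by (simp add: algebra_simps)
    also have "\<dots> \<le> r" using \<eta>(3) nb by (simp add: field_simps)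
    finally have "x \<in> ball b r" by (simp add: dist_norm norm_minus_commute)
    moreover have "x \<in> ?K" unfolding c(3) by (rule exp_path_in_component[OF c(1) bK])
    ultimately show "x \<in> W" using r(2) by blast
  qed
  have Vb: "exp_joined V b x" if "x \<in> V" for x
    using that path_V unfolding exp_joined_def by (force simp: V_def)
  obtain d where d: "d > 0"
    and near: "\<And>x. \<lbrakk>x \<in> sa_roots p; dist b x < d\<rbrakk> \<Longrightarrow> x \<in> V"
  proof -
    obtain d where d: "d > 0" "\<And>x y. \<lbrakk>x \<in> sa_roots p; y \<in> sa_roots p; dist b x < d; dist b y < d\<rbrakk>
       \<Longrightarrow> \<exists>c. self_adjoint c \<and> norm c < \<eta> \<and> exp_path x c 1 = y \<and>
             (\<forall>t\<in>{0..1}. exp_path x c t \<in> sa_roots p \<and> dist b (exp_path x c t) < \<eta>)"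
      using nearby_joined_by_small_exp_path[OF I p bS \<eta>(1)] by blast
    show ?thesis
    proof (rule that[OF d(1)])
      fix x assume "x \<in> sa_roots p" "dist b x < d"
      with d(2)[of b x] bS d(1) show "x \<in> V" by (auto simp: V_def)
    qed
  qed
  obtain e where e: "e > 0"
    and joined: "\<And>x y. \<lbrakk>x \<in> sa_roots p; y \<in> sa_roots p; dist b x < e; dist b y < e\<rbrakk>
       \<Longrightarrow> \<exists>c. self_adjoint c \<and> norm c < d \<and> exp_path x c 1 = y \<and>
             (\<forall>t\<in>{0..1}. exp_path x c t \<in> sa_roots p \<and> dist b (exp_path x c t) < d)"
    using nearby_joined_by_small_exp_path[OF I p bS d] by blast
  define U where "U = ?K \<inter> ball b (min d e)"
  have "openin (top_of_set ?K) U" unfolding U_def by (simp add: openin_open_Int)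
  moreover have "b \<in> U" using bK d e by (simp add: U_def)
  moreover have "U \<subseteq> V" using KS near by (auto simp: U_def)
  moreover have "exp_joined V x y" if "x \<in> U" "y \<in> U" for x y
  proof -
    have "x \<in> sa_roots p" "y \<in> sa_roots p" "dist b x < e" "dist b y < e"
      using that KS by (auto simp: U_def)
    from joined[OF this] show ?thesis unfolding exp_joined_def using near by blast
  qed
  ultimately show "\<exists>U V. openin (top_of_set ?K) U \<and> b \<in> U \<and> U \<subseteq> V \<and> V \<subseteq> W \<and>
      (\<forall>x\<in>V. exp_joined V b x) \<and> (\<forall>x\<in>U. \<forall>y\<in>U. exp_joined V x y)"
    using VW Vb by (intro exI[of _ U] exI[of _ V] conjI ballI)
qed

section \<open>Unitary similarity of nearby self-adjoint roots\<close>

theorem theorem11: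
  fixes n :: nat and lam :: "nat \<Rightarrow> real" and p :: "complex poly"
    and a0 :: "'a::unital_cstar_algebra"
  assumes n: "n \<ge> 2"
    and distinct: "inj_on lam {1..n}"
    and p: "p = (\<Prod>i=1..n. [:- complex_of_real (lam i), 1:])"
    and a0: "a0 \<in> sa_roots p"
  shows "(\<forall>\<epsilon>>0. \<exists>\<delta>>0. \<forall>a1\<in>sa_roots p. norm (a1 - a0) < \<delta> \<longrightarrow>
           (\<exists>c. self_adjoint c \<and> norm c < \<epsilon> \<and>
                unitary (exp (\<i> *\<^sub>C c)) \<and>
                a1 = exp (- \<i> *\<^sub>C c) * a0 * exp (\<i> *\<^sub>C c) \<and>
                exp_path a0 c 0 = a0 \<and> exp_path a0 c 1 = a1 \<and>
                (\<forall>t\<in>{0..1}. exp_path a0 c t \<in> sa_roots p \<and> self_adjoint (exp_path a0 c t)) \<and>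
                real_analytic_on (exp_path a0 c) {0..1} \<and>
                (SUP t\<in>{0..1}. norm (exp_path a0 c t - a0)) < \<epsilon>))
       \<and> locally path_connected (connected_component_set (sa_roots p) a0)
       \<and> locally_exp_path_connected (connected_component_set (sa_roots p) a0)"
proof (intro conjI allI impI)
  define lam' where "lam' = (\<lambda>i. complex_of_real (lam i))"
  have I: "finite {1..n}" "inj_on lam' {1..n}" "{1..n} \<noteq> {}"
    using n inj_on_eq_iff[OF distinct] by (simp_all add: lam'_def inj_on_def)
  have p': "p = (\<Prod>i\<in>{1..n}. [:- lam' i, 1:])" using p by (simp add: lam'_def)
  show loc: "locally_exp_path_connected (connected_component_set (sa_roots p) a0)"
    by (rule components_locally_exp_path_connected[OF I p'])
  then show "locally path_connected (connected_component_set (sa_roots p) a0)"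
    by (rule locally_exp_path_connected_imp_locally_path_connected)
  fix \<epsilon> :: real assume "\<epsilon> > 0"
  then obtain \<delta> where \<delta>: "\<delta> > 0"
    "\<And>x y. \<lbrakk>x \<in> sa_roots p; y \<in> sa_roots p; dist a0 x < \<delta>; dist a0 y < \<delta>\<rbrakk>
       \<Longrightarrow> \<exists>c. self_adjoint c \<and> norm c < \<epsilon> / 2 \<and> exp_path x c 1 = y \<and>
             (\<forall>t\<in>{0..1}. exp_path x c t \<in> sa_roots p \<and> dist a0 (exp_path x c t) < \<epsilon> / 2)"
    using nearby_joined_by_small_exp_path[OF I p' a0, of "\<epsilon> / 2"] by auto
  show "\<exists>\<delta>>0. \<forall>a1\<in>sa_roots p. norm (a1 - a0) < \<delta> \<longrightarrow>
           (\<exists>c. self_adjoint c \<and> norm c < \<epsilon> \<and>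
                unitary (exp (\<i> *\<^sub>C c)) \<and>
                a1 = exp (- \<i> *\<^sub>C c) * a0 * exp (\<i> *\<^sub>C c) \<and>
                exp_path a0 c 0 = a0 \<and> exp_path a0 c 1 = a1 \<and>
                (\<forall>t\<in>{0..1}. exp_path a0 c t \<in> sa_roots p \<and> self_adjoint (exp_path a0 c t)) \<and>
                real_analytic_on (exp_path a0 c) {0..1} \<and>
                (SUP t\<in>{0..1}. norm (exp_path a0 c t - a0)) < \<epsilon>)"
  proof (intro exI[of _ \<delta>] conjI ballI impI \<delta>(1))
    fix a1 assume "a1 \<in> sa_roots p" "norm (a1 - a0) < \<delta>"
    then obtain c where c: "self_adjoint c" "norm c < \<epsilon> / 2" "exp_path a0 c 1 = a1"
      and path: "\<And>t. t \<in> {0..1} \<Longrightarrow> exp_path a0 c t \<in> sa_roots p"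
        "\<And>t. t \<in> {0..1} \<Longrightarrow> dist a0 (exp_path a0 c t) < \<epsilon> / 2"
      using \<delta>(2)[of a0 a1] a0 \<delta>(1) by (auto simp: dist_norm norm_minus_commute)
    have "(SUP t\<in>{0..1}. norm (exp_path a0 c t - a0)) \<le> \<epsilon> / 2"
    proof (rule cSUP_least)
      fix t :: real assume "t \<in> {0..1}"
      then show "norm (exp_path a0 c t - a0) \<le> \<epsilon> / 2"
        using path(2)[of t] by (simp add: dist_norm norm_minus_commute)
    qed simp
    then have sup: "(SUP t\<in>{0..1}. norm (exp_path a0 c t - a0)) < \<epsilon>" using \<open>\<epsilon> > 0\<close> by simp
    have uni: "unitary (exp (\<i> *\<^sub>C c))"
      by (rule unitary_exp_skew(1)[OF star_i_scaleC[OF c(1)]])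
    have a1: "a1 = exp (- \<i> *\<^sub>C c) * a0 * exp (\<i> *\<^sub>C c)"
      using c(3) by (simp add: exp_path_def)
    show "\<exists>c. self_adjoint c \<and> norm c < \<epsilon> \<and>
                unitary (exp (\<i> *\<^sub>C c)) \<and>
                a1 = exp (- \<i> *\<^sub>C c) * a0 * exp (\<i> *\<^sub>C c) \<and>
                exp_path a0 c 0 = a0 \<and> exp_path a0 c 1 = a1 \<and>
                (\<forall>t\<in>{0..1}. exp_path a0 c t \<in> sa_roots p \<and> self_adjoint (exp_path a0 c t)) \<and>
                real_analytic_on (exp_path a0 c) {0..1} \<and>
                (SUP t\<in>{0..1}. norm (exp_path a0 c t - a0)) < \<epsilon>"
      using c uni a1 sup \<open>\<epsilon> > 0\<close> path(1)
      by (intro exI[of _ c]) (auto simp: real_analytic_on_exp_path sa_roots_def)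
  qed
qed

end
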